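(* Let $L_3(x,y,z,w) = 3x+y-2z-2w$. Then, as $N\to\infty$, \[ r_{L_3}(N) \geq N^{\alpha-o(1)}, \qquad \text{where } \alpha = \frac{\log 15}{3\log 5} > 0.5608687, \] i.e. for every $\delta>0$ there is $N_0$ such that $r_{L_3}(N)\ge N^{\alpha-\delta}$ for all integers $N\ge N_0$.
   Context: Let $L(x_1,\dots,x_s)=c_1x_1+\dots+c_sx_s$ with $c_i\in\mathbb{Z}\setminus\{0\}$ and $c_1+\dots+c_s=0$. For a solution $(x_1,\dots,x_s)\in\mathbb{Z}^s$ to $L=0$, let $\mathcal T$ be the partition of $[s]=\{1,\dots,s\}$ in which $i,j$ lie in the same block if and only if $x_i=x_j$. The solution is called trivial if $\sum_{i\in T}c_i=0$ for all $T\in\mathcal T$, and nontrivial otherwise. A set $A\subseteq\mathbb{Z}$ is $L$-free if all solutions $(x_1,\dots,x_s)\in A^s$ to $L=0$ are trivial. Define $r_L(N)=\max\{|A| : A\subseteq\{1,\dots,N\} \text{ is } L\text{-free}\}$. *)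

theory Defs
  imports "HOL-Analysis.Analysis"
begin

text \<open>A linear form \<open>c\<^sub>1 x\<^sub>1 + \<dots> + c\<^sub>s x\<^sub>s\<close> is represented by its list of coefficients, a point
  of \<open>\<int>\<^sup>s\<close> by a list of length \<open>s\<close>; indices run over \<open>{..<s}\<close> instead of \<open>{1..s}\<close>.\<close>

definition invariant_form :: "int list \<Rightarrow> bool" where
  "invariant_form c \<longleftrightarrow> (\<forall>i<length c. c ! i \<noteq> 0) \<and> (\<Sum>i<length c. c ! i) = 0"

definition form_solution :: "int list \<Rightarrow> int list \<Rightarrow> bool" where
  "form_solution c x \<longleftrightarrow> length x = length c \<and> (\<Sum>i<length c. c ! i * x ! i) = 0"

definition equality_partition :: "int list \<Rightarrow> nat set set" where
  "equality_partition x =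
     {..<length x} // {(i, j). i < length x \<and> j < length x \<and> x ! i = x ! j}"

definition trivial_solution :: "int list \<Rightarrow> int list \<Rightarrow> bool" where
  "trivial_solution c x \<longleftrightarrow>
     form_solution c x \<and> (\<forall>T \<in> equality_partition x. (\<Sum>i\<in>T. c ! i) = 0)"

definition form_free :: "int list \<Rightarrow> int set \<Rightarrow> bool" where
  "form_free c A \<longleftrightarrow> (\<forall>x. set x \<subseteq> A \<and> form_solution c x \<longrightarrow> trivial_solution c x)"

definition r_form :: "int list \<Rightarrow> nat \<Rightarrow> nat" where
  "r_form c N = Max {card A | A. A \<subseteq> {1..int N} \<and> form_free c A}"

definition L3 :: "int list" where
  "L3 = [3, 1, -2, -2]"

lemma L3_invariant: "invariant_form L3"
  by (auto simp: invariant_form_def L3_def less_Suc_eq numeral_eq_Suc all_conj_distrib)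

lemma form_free_empty: "form_free c {}"
  by (auto simp: form_free_def trivial_solution_def equality_partition_def)

lemma r_form_Max_wf:
  "finite {card A | A. A \<subseteq> {1..int N} \<and> form_free c A}"
  "{card A | A. A \<subseteq> {1..int N} \<and> form_free c A} \<noteq> {}"
proof -
  have "{card A | A. A \<subseteq> {1..int N} \<and> form_free c A} \<subseteq> card ` Pow {1..int N}"
    by auto
  then show "finite {card A | A. A \<subseteq> {1..int N} \<and> form_free c A}"
    by (rule finite_subset) simp
  show "{card A | A. A \<subseteq> {1..int N} \<and> form_free c A} \<noteq> {}"
    using form_free_empty by blast
qed

end

theory Submission
  imports Defs "HOL-Real_Asymp.Real_Asymp"
begin

text \<open>
  Only constant solutions of \<open>3x + y = 2z + 2w\<close> are trivial. There are 15 vectors in \<open>\<int>\<^sub>5\<^sup>3\<close> and a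
  weight function on them such that every nonconstant solution modulo 5 among them satisfies
  \<open>wt x + wt z + wt w > 3 wt y\<close> (a combinatorial degeneration to the diagonal). Among the words of
  length \<open>m\<close> over this alphabet, those of a fixed total weight therefore form a set
  \<open>S \<subseteq> \<int>\<^sub>5\<^bsup>3m\<^esup>\<close> with only constant solutions modulo 5, and by pigeonhole \<open>|S| \<ge> 15\<^sup>m / O(m)\<close>.

  Now take integer vectors of length \<open>3m\<close> whose base 5 digit vectors all lie in \<open>S\<close>. At the lowest
  position where the four members of a solution differ no carries occur, so the digits there
  solve the equation modulo 5 and hence agree after all. With \<open>n\<close> digits this gives \<open>|S|\<^sup>n\<close> vectors,
  which a positional encoding maps to \<open>{1..5\<^bsup>3m(n+1)\<^esup>}\<close> without creating solutions.
\<close>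

section \<open>The form \<open>l3\<close> and freeness of sets of vectors\<close>

definition l3 :: "int \<Rightarrow> int \<Rightarrow> int \<Rightarrow> int \<Rightarrow> int" where
  "l3 x y z w = 3 * x + y - 2 * z - 2 * w"

text \<open>A vector of length \<open>k\<close> is a function that vanishes from \<open>k\<close>
  on, so equality of functions is equality of vectors.\<close>

definition int_box :: "nat \<Rightarrow> int \<Rightarrow> (nat \<Rightarrow> int) set" where
  "int_box k M = {x. (\<forall>i<k. 0 \<le> x i \<and> x i < M) \<and> (\<forall>i\<ge>k. x i = 0)}"

definition free_vectors :: "nat \<Rightarrow> (nat \<Rightarrow> int) set \<Rightarrow> bool" where
  "free_vectors k T \<longleftrightarrow> (\<forall>x\<in>T. \<forall>y\<in>T. \<forall>z\<in>T. \<forall>w\<in>T.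
     (\<forall>i<k. l3 (x i) (y i) (z i) (w i) = 0) \<longrightarrow> x = y \<and> z = y \<and> w = y)"

definition free_vectors_mod5 :: "nat \<Rightarrow> (nat \<Rightarrow> int) set \<Rightarrow> bool" where
  "free_vectors_mod5 k S \<longleftrightarrow> (\<forall>x\<in>S. \<forall>y\<in>S. \<forall>z\<in>S. \<forall>w\<in>S.
     (\<forall>i<k. 5 dvd l3 (x i) (y i) (z i) (w i)) \<longrightarrow> x = y \<and> z = y \<and> w = y)"

text \<open>A constant solution has a single block, and 3 + 1 - 2 - 2 = 0.\<close>

lemma form_free_L3I:
  assumes "\<And>x y z w. \<lbrakk>x \<in> A; y \<in> A; z \<in> A; w \<in> A; l3 x y z w = 0\<rbrakk> \<Longrightarrow> x = y \<and> z = y \<and> w = y"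
  shows "form_free L3 A"
  unfolding form_free_def
proof (intro allI impI, elim conjE)
  fix v assume v: "set v \<subseteq> A" "form_solution L3 v"
  then have len: "length v = 4"
    by (simp add: form_solution_def L3_def)
  then obtain x y z w where vv: "v = [x, y, z, w]"
    by (auto simp: numeral_eq_Suc length_Suc_conv)
  have "l3 x y z w = 0"
    using v(2) by (simp add: form_solution_def L3_def vv l3_def lessThan_Suc numeral_eq_Suc)
  with assms[of x y z w] v(1) have eq: "v = [y, y, y, y]"
    by (auto simp: vv)
  have "v ! i = y" if "i < 4" for i
    using that by (auto simp: eq less_Suc_eq numeral_eq_Suc)
  then have rel: "{(i, j). i < length v \<and> j < length v \<and> v ! i = v ! j} = {..<4} \<times> {..<4}"
    using len by auto
  have "T = {..<4}" if "T \<in> equality_partition v" for T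
    using that unfolding equality_partition_def rel unfolding len by (auto elim!: quotientE)
  moreover have "(\<Sum>i<4. L3 ! i) = 0"
    by (simp add: L3_def lessThan_Suc numeral_eq_Suc)
  ultimately show "trivial_solution L3 v"
    unfolding trivial_solution_def using v(2) by blast
qed

lemma r_form_ge_card:
  assumes "A \<subseteq> {1..int N}" "form_free c A"
  shows "card A \<le> r_form c N"
  unfolding r_form_def using assms by (intro Max_ge r_form_Max_wf) auto

section \<open>Lifting from residues modulo 5 to integer vectors with \<open>n\<close> base 5
  digits\<close>

lemma free_vectors_lift:
  assumes "S \<subseteq> int_box k 5" "free_vectors_mod5 k S" "finite S"
  shows "\<exists>T \<subseteq> int_box k (5 ^ n). finite T \<and> card T = card S ^ n \<and> free_vectors k T"
proof (induction n)
  case 0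
  show ?case
    by (rule exI[of _ "{\<lambda>_. 0}"]) (auto simp: int_box_def free_vectors_def)
next
  case (Suc n)
  then obtain T where T: "T \<subseteq> int_box k (5 ^ n)" "finite T" "card T = card S ^ n" "free_vectors k T"
    by blast
  define f :: "(nat \<Rightarrow> int) \<times> (nat \<Rightarrow> int) \<Rightarrow> nat \<Rightarrow> int" where "f = (\<lambda>(s, p) i. s i + 5 * p i)"
  have low: "s i = (s i + 5 * p i) mod 5" if "s \<in> S" for s p :: "nat \<Rightarrow> int" and i
  proof (cases "i < k")
    case True
    then have "0 \<le> s i" "s i < 5" using that assms(1) by (auto simp: int_box_def)
    then show ?thesis by simp
  next
    case False
    then have "s i = 0" using that assms(1) by (auto simp: int_box_def)
    then show ?thesis by simp
  qed
  have inj: "inj_on f (S \<times> T)"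
  proof (rule inj_onI, clarify)
    fix s p s' p' assume a: "s \<in> S" "s' \<in> S" "f (s, p) = f (s', p')"
    have e: "s i + 5 * p i = s' i + 5 * p' i" for i
      using fun_cong[OF a(3), of i] by (simp add: f_def)
    have "s i = s' i" for i
      using low[OF a(1), of i p] low[OF a(2), of i p'] e[of i] by simp
    then show "s = s' \<and> p = p'" using e by auto
  qed
  have "f ` (S \<times> T) \<subseteq> int_box k (5 ^ Suc n)"
  proof clarify
    fix s p assume sp: "s \<in> S" "p \<in> T"
    have "0 \<le> s i + 5 * p i \<and> s i + 5 * p i < 5 * 5 ^ n" if "i < k" for i
    proof -
      have "0 \<le> s i" "s i < 5" "0 \<le> p i" "p i < 5 ^ n"
        using sp that assms(1) T(1) by (auto simp: int_box_def)
      then show ?thesis by linarith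
    qed
    moreover have "s i + 5 * p i = 0" if "k \<le> i" for i
    proof -
      have "s i = 0" "p i = 0"
        using sp that assms(1) T(1) by (auto simp: int_box_def)
      then show ?thesis by simp
    qed
    ultimately show "f (s, p) \<in> int_box k (5 ^ Suc n)"
      by (simp add: f_def int_box_def)
  qed
  moreover have "finite (f ` (S \<times> T))"
    using assms(3) T(2) by simp
  moreover have "card (f ` (S \<times> T)) = card S ^ Suc n"
    by (simp add: card_image[OF inj] card_cartesian_product T(3))
  moreover have "free_vectors k (f ` (S \<times> T))"
    unfolding free_vectors_def
  proof (clarify del: conjI)
    fix s1 p1 s2 p2 s3 p3 s4 p4
    assume S: "s1 \<in> S" "s2 \<in> S" "s3 \<in> S" "s4 \<in> S" and P: "p1 \<in> T" "p2 \<in> T" "p3 \<in> T" "p4 \<in> T"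
      and sol: "\<forall>i<k. l3 (f (s1, p1) i) (f (s2, p2) i) (f (s3, p3) i) (f (s4, p4) i) = 0"
    have split: "l3 (s1 i) (s2 i) (s3 i) (s4 i) = - 5 * l3 (p1 i) (p2 i) (p3 i) (p4 i)" if "i < k" for i
      using sol[rule_format, OF that] by (simp add: f_def l3_def)
    then have "\<forall>i<k. 5 dvd l3 (s1 i) (s2 i) (s3 i) (s4 i)"
      by simp
    then have s: "s1 = s2" "s3 = s2" "s4 = s2"
      using assms(2) S unfolding free_vectors_mod5_def by blast+
    \<comment> \<open>Once the lowest digits agree, their share vanishes since the coefficients sum
      to 0; the factor 5 cancels.\<close>
    have "l3 (p1 i) (p2 i) (p3 i) (p4 i) = 0" if "i < k" for i
      using split[OF that] by (simp add: s l3_def)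
    then have "p1 = p2" "p3 = p2" "p4 = p2"
      using T(4) P unfolding free_vectors_def by blast+
    with s show "f (s1, p1) = f (s2, p2) \<and> f (s3, p3) = f (s2, p2) \<and> f (s4, p4) = f (s2, p2)"
      by simp
  qed
  ultimately show ?case by blast
qed

section \<open>Positional encoding of vectors as integers\<close>

text \<open>\<open>B\<close> divides the lowest coefficient, which is smaller than \<open>B\<close>
  in absolute value and hence 0. Cancelling one \<open>B\<close> leaves the same problem with one
  digit fewer.\<close>

lemma zero_if_positional_sum_zero:
  fixes c :: "nat \<Rightarrow> int"
  assumes "(\<Sum>i<k. c i * B ^ i) = 0" "\<And>i. i < k \<Longrightarrow> \<bar>c i\<bar> < B" "i < k"
  shows "c i = 0"
  using assms
proof (induction k arbitrary: c i)
  case (Suc k)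
  have "B > 0" using Suc.prems(2)[OF Suc.prems(3)] by linarith
  have sum: "c 0 + B * (\<Sum>i<k. c (Suc i) * B ^ i) = 0"
    using Suc.prems(1) by (simp add: sum.lessThan_Suc_shift sum_distrib_left mult_ac del: sum.lessThan_Suc)
  then have "B dvd c 0"
    by (metis add_eq_0_iff dvd_minus_iff dvd_triv_left)
  then have 0: "c 0 = 0"
    using Suc.prems(2)[of 0] zdvd_imp_le[of B "\<bar>c 0\<bar>"] by force
  with sum \<open>B > 0\<close> have "(\<Sum>i<k. c (Suc i) * B ^ i) = 0"
    by simp
  then have "c (Suc j) = 0" if "j < k" for j
    using Suc.IH[of "\<lambda>i. c (Suc i)" j] Suc.prems(2) that by simp
  with 0 Suc.prems(3) show ?case
    by (cases i) auto
qed simp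

lemma positional_sum_bounds:
  fixes x :: "nat \<Rightarrow> int"
  assumes "\<And>i. i < k \<Longrightarrow> 0 \<le> x i \<and> x i < B"
  shows "0 \<le> (\<Sum>i<k. x i * B ^ i) \<and> (\<Sum>i<k. x i * B ^ i) < B ^ k"
  using assms
proof (induction k)
  case (Suc k)
  have "0 \<le> x k" "x k \<le> B - 1" using Suc.prems[of k] by auto
  then have "B > 0" by linarith
  have "x k * B ^ k \<le> (B - 1) * B ^ k"
    using \<open>x k \<le> B - 1\<close> \<open>B > 0\<close> by (intro mult_right_mono) auto
  moreover have "0 \<le> x k * B ^ k" using \<open>0 \<le> x k\<close> \<open>B > 0\<close> by simp
  ultimately show ?case using Suc.IH Suc.prems by (simp add: algebra_simps)
qed simp

lemma r_form_ge_free_vectors: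
  assumes T: "T \<subseteq> int_box k (int M)" "free_vectors k T" and N: "(5 * M) ^ k \<le> N"
  shows "card T \<le> r_form L3 N"
proof -
  \<comment> \<open>Entries in \<open>{0..<M}\<close> give values of \<open>l3\<close> of size at
    most 4 (M - 1), so base 5 M separates the coordinates.\<close>
  define B where "B = 5 * int M"
  \<comment> \<open>The 1 shifts the range to \<open>{1..B ^ k}\<close>; it drops out of
    \<open>l3\<close>, whose coefficients sum to 0.\<close>
  define e where "e x = 1 + (\<Sum>i<k. x i * B ^ i)" for x :: "nat \<Rightarrow> int"
  have bd: "0 \<le> x i \<and> x i < int M" if "x \<in> T" "i < k" for x i
    using that T(1) by (auto simp: int_box_def)
  have l3_e: "l3 (e x) (e y) (e z) (e w) = (\<Sum>i<k. l3 (x i) (y i) (z i) (w i) * B ^ i)" for x y z w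
    by (simp add: e_def l3_def sum_distrib_left sum.distrib sum_subtractf algebra_simps)
  have key: "x = y \<and> z = y \<and> w = y"
    if "x \<in> T" "y \<in> T" "z \<in> T" "w \<in> T" "l3 (e x) (e y) (e z) (e w) = 0" for x y z w
  proof -
    have "\<bar>l3 (x i) (y i) (z i) (w i)\<bar> < B" if "i < k" for i
      using bd[OF \<open>x \<in> T\<close> that] bd[OF \<open>y \<in> T\<close> that] bd[OF \<open>z \<in> T\<close> that] bd[OF \<open>w \<in> T\<close> that]
      unfolding l3_def B_def by linarith
    then have "\<forall>i<k. l3 (x i) (y i) (z i) (w i) = 0"
      using zero_if_positional_sum_zero[of "\<lambda>i. l3 (x i) (y i) (z i) (w i)" B k] that(5) l3_e by auto
    then show ?thesis
      using T(2) that unfolding free_vectors_def by blast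
  qed
  have "inj_on e T"
  proof (rule inj_onI)
    fix x y assume "x \<in> T" "y \<in> T" "e x = e y"
    \<comment> \<open>Since \<open>l3 a b a a = b - a\<close>, equal codes make (x, y, x, x) a
      solution, so injectivity is a case of \<open>key\<close>.\<close>
    then show "x = y" using key[of x y x x] by (simp add: l3_def)
  qed
  moreover have "e ` T \<subseteq> {1..int N}"
  proof clarify
    fix x assume "x \<in> T"
    then have "0 \<le> (\<Sum>i<k. x i * B ^ i) \<and> (\<Sum>i<k. x i * B ^ i) < B ^ k"
      using bd unfolding B_def by (intro positional_sum_bounds) fastforce
    moreover have "B ^ k \<le> int N"
      using N unfolding B_def by (metis of_nat_le_iff of_nat_mult of_nat_numeral of_nat_power)
    ultimately show "e x \<in> {1..int N}"
      by (simp add: e_def)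
  qed
  moreover have "form_free L3 (e ` T)"
    by (rule form_free_L3I) (use key in blast)
  ultimately show ?thesis
    using r_form_ge_card[of "e ` T" N L3] by (simp add: card_image)
qed

section \<open>Free sets modulo 5 from weighted alphabets\<close>

text \<open>Summing \<open>deg\<close> over the letters gives 3 total y \<le> total x + total z +
  total w, strictly if some position is nonconstant. Words of equal total weight give equality, so
  every position is constant. The total takes at most K m + 1 values, hence the pigeonhole
  bound.\<close>

lemma weighted_alphabet_free_vectors:
  fixes D :: "'d set" and dig :: "'d \<Rightarrow> nat \<Rightarrow> int" and wt :: "'d \<Rightarrow> nat"
  assumes D: "finite D"
    and dig: "\<And>d t. \<lbrakk>d \<in> D; t < q\<rbrakk> \<Longrightarrow> 0 \<le> dig d t \<and> dig d t < 5"
    and wt: "\<And>d. d \<in> D \<Longrightarrow> wt d \<le> K"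
    and deg: "\<And>x y z w. \<lbrakk>x \<in> D; y \<in> D; z \<in> D; w \<in> D;
                 \<And>t. t < q \<Longrightarrow> 5 dvd l3 (dig x t) (dig y t) (dig z t) (dig w t)\<rbrakk>
               \<Longrightarrow> x = y \<and> z = y \<and> w = y \<or> 3 * wt y < wt x + wt z + wt w"
  shows "\<exists>S \<subseteq> int_box (q * m) 5. finite S \<and> card D ^ m \<le> card S * (K * m + 1) \<and>
           free_vectors_mod5 (q * m) S"
proof -
  define W where "W = ({..<m} \<rightarrow>\<^sub>E D)"
  define total where "total u = (\<Sum>j<m. wt (u j))" for u :: "nat \<Rightarrow> 'd"
  have letter: "u j \<in> D" if "u \<in> W" "j < m" for u j
    using that by (auto simp: W_def)
  have finW: "finite W" and cardW: "card W = card D ^ m"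
    using D by (auto simp: W_def finite_PiE card_PiE)
  have "total u \<le> K * m" if "u \<in> W" for u
    using sum_bounded_above[of "{..<m}" "\<lambda>j. wt (u j)" K] wt letter[OF that]
    by (simp add: total_def mult.commute)
  then have "total \<in> W \<rightarrow> {..K * m}"
    by auto
  from pigeonhole_card[OF this finW] obtain c
    where c: "card W \<le> card (total -` {c} \<inter> W) * (K * m + 1)"
    by auto
  define F where "F = total -` {c} \<inter> W"
  \<comment> \<open>Concatenates the digit blocks of the letters: block \<open>j\<close> occupies
    the coordinates from q j to q j + q - 1.\<close>
  define g where "g u i = (if i < q * m then dig (u (i div q)) (i mod q) else 0)"
    for u :: "nat \<Rightarrow> 'd" and i
  have key: "x = y \<and> z = y \<and> w = y"
    if F: "x \<in> F" "y \<in> F" "z \<in> F" "w \<in> F"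
      and sol: "\<forall>i<q * m. 5 dvd l3 (g x i) (g y i) (g z i) (g w i)" for x y z w
  proof -
    have W: "x \<in> W" "y \<in> W" "z \<in> W" "w \<in> W"
      and tot: "total x = c" "total y = c" "total z = c" "total w = c"
      using F by (auto simp: F_def)
    have alt: "x j = y j \<and> z j = y j \<and> w j = y j \<or> 3 * wt (y j) < wt (x j) + wt (z j) + wt (w j)"
      if "j < m" for j
    proof (rule deg)
      fix t assume "t < q"
      have "q * j + t < q * Suc j" using \<open>t < q\<close> by simp
      also have "\<dots> \<le> q * m" using \<open>j < m\<close> by (intro mult_le_mono) auto
      finally have "q * j + t < q * m" .
      with sol have "5 dvd l3 (g x (q * j + t)) (g y (q * j + t)) (g z (q * j + t)) (g w (q * j + t))"
        by blast
      then show "5 dvd l3 (dig (x j) t) (dig (y j) t) (dig (z j) t) (dig (w j) t)"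
        using \<open>t < q\<close> \<open>q * j + t < q * m\<close> by (simp add: g_def)
    qed (use W letter that in auto)
    have sums: "(\<Sum>j<m. 3 * wt (y j)) = (\<Sum>j<m. wt (x j) + wt (z j) + wt (w j))"
      using tot by (simp add: total_def sum.distrib flip: sum_distrib_left)
    have "3 * wt (y j) \<le> wt (x j) + wt (z j) + wt (w j)" if "j < m" for j
      using alt[OF that] by auto
    then have "\<not> 3 * wt (y j) < wt (x j) + wt (z j) + wt (w j)" if "j < m" for j
      using sums that sum_strict_mono_ex1[of "{..<m}" "\<lambda>j. 3 * wt (y j)"
          "\<lambda>j. wt (x j) + wt (z j) + wt (w j)"] by auto
    with alt have "x j = y j \<and> z j = y j \<and> w j = y j" if "j < m" for j
      using that by blast
    then show ?thesis
      using W unfolding W_def by (metis PiE_ext lessThan_iff)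
  qed
  have inj: "inj_on g F"
  proof (rule inj_onI)
    fix x y assume "x \<in> F" "y \<in> F" "g x = g y"
    then show "x = y" using key[of x y x x] by (simp add: l3_def)
  qed
  have "g ` F \<subseteq> int_box (q * m) 5"
  proof clarify
    fix u assume "u \<in> F"
    then have "u \<in> W" by (simp add: F_def)
    have "0 \<le> g u i \<and> g u i < 5" if "i < q * m" for i
    proof -
      have "i div q < m" using that by (simp add: less_mult_imp_div_less mult.commute)
      moreover have "i mod q < q" using that by (cases "q = 0") auto
      ultimately show ?thesis
        using dig letter[OF \<open>u \<in> W\<close>] that by (simp add: g_def)
    qed
    then show "g u \<in> int_box (q * m) 5"
      by (simp add: int_box_def) (simp add: g_def)
  qed
  moreover have "finite (g ` F)"
    using finW by (simp add: F_def)
  moreover have "card D ^ m \<le> card (g ` F) * (K * m + 1)"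
    unfolding card_image[OF inj] using c by (simp add: cardW F_def)
  moreover have "free_vectors_mod5 (q * m) (g ` F)"
    unfolding free_vectors_mod5_def using key by blast
  ultimately show ?thesis by blast
qed

text \<open>Found by computer search; the second components are the weights.\<close>

definition alphabet :: "(int list \<times> nat) list" where
  "alphabet =
    [([0,3,2], 0), ([2,2,2], 0), ([4,0,1], 0), ([2,3,3], 1), ([1,4,1], 1),
     ([2,4,2], 2), ([4,2,1], 2), ([1,1,1], 2), ([0,0,1], 3), ([0,3,4], 3),
     ([2,2,0], 8), ([1,4,4], 8), ([0,0,3], 23), ([0,1,4], 62), ([1,0,4], 187)]"

text \<open>An exhaustive check of the 15^4 quadruples of letters.\<close>

lemma alphabet_degeneration:
  "\<forall>x\<in>set alphabet. \<forall>z\<in>set alphabet. \<forall>w\<in>set alphabet. \<forall>y\<in>set alphabet.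
     5 dvd l3 (fst x ! 0) (fst y ! 0) (fst z ! 0) (fst w ! 0) \<longrightarrow>
     5 dvd l3 (fst x ! 1) (fst y ! 1) (fst z ! 1) (fst w ! 1) \<longrightarrow>
     5 dvd l3 (fst x ! 2) (fst y ! 2) (fst z ! 2) (fst w ! 2) \<longrightarrow>
       x = y \<and> z = y \<and> w = y \<or> 3 * snd y < snd x + snd z + snd w"
  by code_simp

text \<open>The general construction with 15 letters of 3 digits each; 187 is the largest
  weight.\<close>

lemma alphabet_free_vectors:
  "\<exists>S \<subseteq> int_box (3 * m) 5. finite S \<and> 15 ^ m \<le> card S * (187 * m + 1) \<and> free_vectors_mod5 (3 * m) S"
proof -
  have "card (set alphabet) = 15"
    by (simp add: alphabet_def)
  moreover have "\<exists>S \<subseteq> int_box (3 * m) 5. finite S \<and> card (set alphabet) ^ m \<le> card S * (187 * m + 1) \<and>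
      free_vectors_mod5 (3 * m) S"
  proof (rule weighted_alphabet_free_vectors[where dig = "\<lambda>d t. fst d ! t" and wt = snd])
    fix d t assume "d \<in> set alphabet" "t < (3 :: nat)"
    then show "0 \<le> fst d ! t \<and> fst d ! t < 5"
      by (auto simp: alphabet_def less_Suc_eq numeral_eq_Suc)
  next
    fix x y z w
    assume "x \<in> set alphabet" "y \<in> set alphabet" "z \<in> set alphabet" "w \<in> set alphabet"
      and "\<And>t. t < (3 :: nat) \<Longrightarrow> 5 dvd l3 (fst x ! t) (fst y ! t) (fst z ! t) (fst w ! t)"
    then show "x = y \<and> z = y \<and> w = y \<or> 3 * snd y < snd x + snd z + snd w"
      using alphabet_degeneration by simp
  qed (auto simp: alphabet_def)
  ultimately show ?thesis by simp
qed

section \<open>Growth of \<open>r_form L3\<close> and the exponent\<close>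

text \<open>Here \<open>s\<close> depends on \<open>m\<close> only. The exponent
  \<open>n + 1\<close> instead of \<open>n\<close> comes from the encoding base 5 * 5^n.\<close>

lemma r_form_L3_ge_power:
  "\<exists>s. 15 ^ m \<le> s * (187 * m + 1) \<and> (\<forall>n N. (5 ^ (3 * m)) ^ (n + 1) \<le> N \<longrightarrow> s ^ n \<le> r_form L3 N)"
proof -
  obtain S where S: "S \<subseteq> int_box (3 * m) 5" "finite S" "15 ^ m \<le> card S * (187 * m + 1)"
    "free_vectors_mod5 (3 * m) S"
    using alphabet_free_vectors by blast
  have "card S ^ n \<le> r_form L3 N" if N: "(5 ^ (3 * m)) ^ (n + 1) \<le> N" for n N
  proof -
    obtain T where T: "T \<subseteq> int_box (3 * m) (5 ^ n)" "card T = card S ^ n" "free_vectors (3 * m) T"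
      using free_vectors_lift[OF S(1,4,2)] by blast
    have "(5 * 5 ^ n) ^ (3 * m) \<le> N"
      using N by (simp add: mult.commute flip: power_mult power_Suc)
    then show ?thesis
      using r_form_ge_free_vectors[of T "3 * m" "5 ^ n" N] T by simp
  qed
  with S(3) show ?thesis by blast
qed

text \<open>The loss \<delta> is split in two: one half absorbs the factor 187 m + 1 by a large
  fixed \<open>m\<close>, the other the rounding of \<open>N\<close> to a power of 5^(3m) by large
  \<open>n\<close>.\<close>

lemma r_form_L3_lower_bound:
  fixes \<delta> :: real
  assumes "\<delta> > 0"
  shows "\<exists>N0. \<forall>N\<ge>N0. real N powr (ln 15 / (3 * ln 5) - \<delta>) \<le> real (r_form L3 N)"
proof (cases "ln 15 / (3 * ln 5) - \<delta> > 0")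
  \<comment> \<open>For a nonpositive exponent the power is at most 1, and the case
    \<open>m = 0\<close> with \<open>s ^ 0 = 1\<close> gives a nonempty free set.\<close>
  case False
  have "real N powr (ln 15 / (3 * ln 5) - \<delta>) \<le> real (r_form L3 N)" if "N \<ge> 1" for N
  proof -
    have "1 \<le> r_form L3 N"
      using r_form_L3_ge_power[of 0] that by (metis mult_0_right power.simps(1) power_one)
    moreover have "real N powr (ln 15 / (3 * ln 5) - \<delta>) \<le> real N powr 0"
      using False that by (intro powr_mono) auto
    ultimately show ?thesis using that by simp
  qed
  then show ?thesis by blast
next
  case True
  define \<gamma> where "\<gamma> = ln 15 / (3 * ln 5) - \<delta>"
  have "(\<lambda>m. ln (187 * real m + 1) / real m) \<longlonglongrightarrow> 0"
    by real_asymp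
  then have "\<forall>\<^sub>F m in sequentially. ln (187 * real m + 1) / real m < 3 * ln 5 * \<delta> / 2"
    using assms by (intro order_tendstoD) auto
  with eventually_gt_at_top[of 0]
  have "\<forall>\<^sub>F m in sequentially. m > 0 \<and> ln (187 * real m + 1) / real m < 3 * ln 5 * \<delta> / 2"
    by eventually_elim auto
  then obtain m where m: "m > 0" "ln (187 * real m + 1) / real m < 3 * ln 5 * \<delta> / 2"
    by (metis (mono_tags, lifting) eventually_sequentially order_refl)
  obtain s where s: "15 ^ m \<le> s * (187 * m + 1)"
    and r: "\<And>n N. (5 ^ (3 * m)) ^ (n + 1) \<le> N \<Longrightarrow> s ^ n \<le> r_form L3 N"
    using r_form_L3_ge_power[of m] by blast
  \<comment> \<open>This is the logarithm of 5^(3m), the base in which \<open>N\<close> is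
    measured.\<close>
  define \<kappa> where "\<kappa> = 3 * real m * ln 5"
  have "\<kappa> > 0" using m by (simp add: \<kappa>_def)
  have "s > 0" using s by (cases "s = 0") auto
  have "real (15 ^ m) \<le> real (s * (187 * m + 1))"
    using s by (rule of_nat_mono)
  then have "ln (15 ^ m) \<le> ln (real s * (187 * real m + 1))"
    using \<open>s > 0\<close> by (intro ln_mono) (simp_all add: algebra_simps)
  also have "\<dots> = ln s + ln (187 * real m + 1)"
    using \<open>s > 0\<close> by (subst ln_mult) auto
  finally have "real m * ln 15 \<le> ln s + ln (187 * real m + 1)"
    by (simp add: ln_realpow)
  moreover have "ln (187 * real m + 1) < \<kappa> * (\<delta> / 2)"
    using m by (simp add: \<kappa>_def field_simps)
  moreover have "real m * ln 15 = \<kappa> * (\<gamma> + \<delta>)"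
    by (simp add: \<kappa>_def \<gamma>_def field_simps)
  ultimately have ln_s: "\<kappa> * (\<gamma> + \<delta> / 2) \<le> ln s"
    by (simp add: algebra_simps)
  \<comment> \<open>For n \<ge> 4 \<gamma> / \<delta> the surplus n \<delta> / 2 covers the 2
    \<gamma> by which (n + 2) \<gamma> exceeds n \<gamma>.\<close>
  obtain n0 :: nat where n0: "4 * \<gamma> / \<delta> \<le> real n0"
    using real_arch_simple by blast
  have "real N powr \<gamma> \<le> real (r_form L3 N)" if N: "N \<ge> (5 ^ (3 * m)) ^ (n0 + 2)" for N
  proof -
    have b: "(5 :: nat) ^ (3 * m) \<ge> 2"
      using m power_increasing[of 1 "3 * m" "5 :: nat"] by simp
    have "N \<ge> 1" using N by (metis le_trans one_le_numeral one_le_power)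
    obtain l where l: "(5 ^ (3 * m)) ^ l \<le> N" "N < (5 ^ (3 * m)) ^ (l + 1)"
      using ex_power_ivl1[OF b \<open>N \<ge> 1\<close>] by blast
    have "(5 ^ (3 * m)) ^ (n0 + 2) < ((5 :: nat) ^ (3 * m)) ^ (l + 1)"
      using N l(2) by linarith
    then have "n0 + 2 < l + 1"
      using b by (subst (asm) power_strict_increasing_iff) auto
    \<comment> \<open>Now \<open>N\<close> lies between the powers n + 1 and n + 2 of 5^(3m): the
      lower one admits \<open>s ^ n\<close>, the upper one bounds
      \<open>N powr \<gamma>\<close>.\<close>
    define n where "n = l - 1"
    have n: "l = n + 1" "n \<ge> n0"
      using \<open>n0 + 2 < l + 1\<close> by (auto simp: n_def)
    have "\<gamma> * 4 \<le> real n0 * \<delta>" using n0 assms by (simp add: field_simps)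
    also have "\<dots> \<le> real n * \<delta>" using n assms by simp
    finally have "(real n + 2) * \<gamma> \<le> real n * (\<gamma> + \<delta> / 2)"
      by (simp add: algebra_simps)
    then have "\<kappa> * ((real n + 2) * \<gamma>) \<le> \<kappa> * (real n * (\<gamma> + \<delta> / 2))"
      using \<open>\<kappa> > 0\<close> by (intro mult_left_mono) auto
    also have "\<dots> \<le> real n * ln s"
      using ln_s mult_left_mono[of "\<kappa> * (\<gamma> + \<delta> / 2)" "ln s" "real n"] by (simp add: mult_ac)
    finally have exps: "\<kappa> * ((real n + 2) * \<gamma>) \<le> real n * ln s" .
    have "real N \<le> real ((5 ^ (3 * m)) ^ (n + 2))"
      using l(2) n by (intro of_nat_mono) auto
    also have "\<dots> = exp (ln 5) ^ (3 * m * (n + 2))"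
      by (simp only: of_nat_power of_nat_numeral power_mult exp_ln zero_less_numeral)
    also have "\<dots> = exp (real (3 * m * (n + 2)) * ln 5)"
      by (rule exp_of_nat_mult[symmetric])
    also have "real (3 * m * (n + 2)) * ln 5 = \<kappa> * (real n + 2)"
      by (simp add: \<kappa>_def algebra_simps)
    finally have "real N powr \<gamma> \<le> exp (\<kappa> * (real n + 2)) powr \<gamma>"
      using True by (intro powr_mono2) (auto simp: \<gamma>_def)
    also have "\<dots> = exp (\<kappa> * ((real n + 2) * \<gamma>))"
      by (simp add: powr_def mult_ac)
    also have "\<dots> \<le> exp (real n * ln s)"
      using exps by simp
    also have "\<dots> = real (s ^ n)"
      using \<open>s > 0\<close> by (simp add: exp_of_nat_mult)
    also have "\<dots> \<le> real (r_form L3 N)"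
      using r[of n N] l(1) n by (intro of_nat_mono) auto
    finally show ?thesis .
  qed
  then show ?thesis unfolding \<gamma>_def by blast
qed

lemma exponent_gt: "ln 15 / (3 * ln 5) > (0.5608687::real)"
proof -
  define p q r :: real where "p = ln (16/15)" and "q = ln (25/24)" and "r = ln (81/80)"
  have fac: "ln 15 = ln 3 + ln (5::real)" "ln 16 = 4 * ln (2::real)" "ln 25 = 2 * ln (5::real)"
    "ln 24 = 3 * ln 2 + ln (3::real)" "ln 81 = 4 * ln (3::real)" "ln 80 = 4 * ln 2 + ln (5::real)"
    using ln_mult[of 3 "5::real"] ln_realpow[of 2 4] ln_realpow[of 5 2] ln_mult[of "2^3" "3::real"]
      ln_realpow[of 2 3] ln_realpow[of 3 4] ln_mult[of "2^4" "5::real"] by simp_all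
  \<comment> \<open>The logarithms of 3 and 5 are integer combinations of these three, whose series converge fast.\<close>
  have pqr: "p = 4 * ln 2 - ln 3 - ln 5" "q = 2 * ln 5 - 3 * ln 2 - ln 3" "r = 4 * ln 3 - 4 * ln 2 - ln 5"
    unfolding p_def q_def r_def by (simp_all add: ln_div fac)
  \<comment> \<open>As ln 3 = 11 p + 8 q + 5 r and ln 5 = 16 p + 12 q + 7 r, the difference ln 3 -
    0.6826061 ln 5 has positive coefficients at \<open>p\<close> and \<open>r\<close> and a negative
    one at \<open>q\<close>, which fixes the direction of each bound.\<close>
  have "p \<ge> 645385211 / 10000000000"
    using ln_approx_bounds[of "16/15" 3] by (simp add: p_def eval_nat_numeral)
  moreover have "q \<le> 408219946 / 10000000000"
    using ln_approx_bounds[of "25/24" 3] by (simp add: q_def eval_nat_numeral)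
  moreover have "r \<ge> 124225199 / 10000000000"
    using ln_approx_bounds[of "81/80" 3] by (simp add: r_def eval_nat_numeral)
  \<comment> \<open>The constant is 3 * 0.5608687 - 1, from ln 15 = ln 3 + ln 5.\<close>
  ultimately have "6826061 / 10000000 * ln (5::real) < ln 3"
    unfolding pqr by linarith
  then show ?thesis by (simp add: field_simps fac)
qed

theorem theorem1:
  shows "(\<forall>\<delta>::real. \<delta> > 0 \<longrightarrow>
            (\<exists>N0::nat. \<forall>N\<ge>N0.
               real (r_form L3 N) \<ge> real N powr (ln 15 / (3 * ln 5) - \<delta>)))
         \<and> ln 15 / (3 * ln 5) > (0.5608687::real)"
  using r_form_L3_lower_bound exponent_gt by blast

end
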